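(* Let $\mathit{Atm}_0$ be finite. Then the logic $\mathsf{PLC}$ is sound and complete relative to the class $\mathbf{MDM}$: a formula of $\mathcal{L}$ is a theorem of $\mathsf{PLC}$ if and only if it is valid in every multi-decision model.
   Context: Let $\mathit{Atm}_0$ be a set of atomic propositions and $\mathit{Val}$ a finite set of output values; decision atoms $\mathsf{t}(x)$ for $x\in\mathit{Val}$, $\mathit{Dec}=\{\mathsf{t}(x):x\in\mathit{Val}\}$, $\mathit{Atm}=\mathit{Atm}_0\cup\mathit{Dec}$. Language $\mathcal{L}$: $\varphi ::= p \mid \mathsf{t}(x)\mid \neg\varphi\mid \varphi\wedge\varphi\mid \Box_{\mathtt{I}}\varphi\mid \Box_{\mathtt{F}}\varphi$ ($p\in\mathit{Atm}_0$, $x\in\mathit{Val}$). For finite $X,Y\subseteq\mathit{Atm}_0$ let $\mathrm{cn}_{X,Y}=\bigwedge_{p\in X}p\wedge\bigwedge_{p\in Y\setminus X}\neg p$. The logic $\mathsf{PLC}$ (for finite $\mathit{Atm}_0$) is the extension of classical propositional logic by the following axioms and rules, where $\blacksquare$ ranges over $\{\Box_{\mathtt{I}},\Box_{\mathtt{F}}\}$: K: $(\blacksquare\varphi\wedge\blacksquare(\varphi\to\psi))\to\blacksquare\psi$; T: $\blacksquare\varphi\to\varphi$; 4: $\blacksquare\varphi\to\blacksquare\blacksquare\varphi$; 5: $\neg\blacksquare\varphi\to\blacksquare\neg\blacksquare\varphi$; Comm: $\Box_{\mathtt{F}}\Box_{\mathtt{I}}\varphi\leftrightarrow\Box_{\mathtt{I}}\Box_{\mathtt{F}}\varphi$;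 AtLeast: $\bigvee_{x\in\mathit{Val}}\mathsf{t}(x)$; AtMost: $\mathsf{t}(x)\to\neg\mathsf{t}(y)$ for $x\neq y$; Funct: $(\mathrm{cn}_{X,\mathit{Atm}_0}\wedge\mathsf{t}(x))\to\Box_{\mathtt{I}}(\mathrm{cn}_{X,\mathit{Atm}_0}\to\mathsf{t}(x))$ for $X\subseteq\mathit{Atm}_0$, $x\in\mathit{Val}$; Indep: $p\to\Box_{\mathtt{F}}p$ and $\neg p\to\Box_{\mathtt{F}}\neg p$ for $p\in\mathit{Atm}_0$; Nec: from $\varphi$ infer $\blacksquare\varphi$. A multi-decision model (MDM) is a tuple $M=(W,\sim_{\Box_{\mathtt{I}}},\sim_{\Box_{\mathtt{F}}},V)$ with $W$ a set, $\sim_{\Box_{\mathtt{I}}},\sim_{\Box_{\mathtt{F}}}$ equivalence relations on $W$, $V:W\to2^{\mathit{Atm}}$, writing $V_Y(w)=V(w)\cap Y$, such that for all $w,v\in W$, $x,y\in\mathit{Val}$: (C1) $\sim_{\Box_{\mathtt{I}}}\circ\sim_{\Box_{\mathtt{F}}}=\sim_{\Box_{\mathtt{F}}}\circ\sim_{\Box_{\mathtt{I}}}$; (C2) if $V_{\mathit{Atm}_0}(w)=V_{\mathit{Atm}_0}(v)$ and $w\sim_{\Box_{\mathtt{I}}}v$ then $V_{\mathit{Dec}}(w)=V_{\mathit{Dec}}(v)$; (C3) if $w\sim_{\Box_{\mathtt{F}}}v$ then $V_{\mathit{Atm}_0}(w)=V_{\mathit{Atm}_0}(v)$; (C4) if $\mathsf{t}(x)\in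 V(w)$ and $x\neq y$ then $\mathsf{t}(y)\notin V(w)$; (C5) some $\mathsf{t}(x)\in V(w)$. Truth: atoms $q\in\mathit{Atm}$ true at $w$ iff $q\in V(w)$; Boolean connectives as usual; $\Box_{\mathtt{I}}\varphi$ (resp. $\Box_{\mathtt{F}}\varphi$) true at $w$ iff $\varphi$ true at all $\sim_{\Box_{\mathtt{I}}}$- (resp. $\sim_{\Box_{\mathtt{F}}}$-) related worlds. *)

theory Defs
  imports Main
begin

datatype modality = MI | MF

datatype ('p, 'v) atom = Prop 'p | Dec 'v

datatype ('p, 'v) fm =
    Atom "('p, 'v) atom"
  | Neg "('p, 'v) fm"
  | Conj "('p, 'v) fm" "('p, 'v) fm"
  | Box modality "('p, 'v) fm"

abbreviation Atms :: "'p set \<Rightarrow> 'v set \<Rightarrow> ('p, 'v) atom set" where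
  "Atms Atm0 Val \<equiv> Prop ` Atm0 \<union> Dec ` Val"

inductive_set Lang :: "'p set \<Rightarrow> 'v set \<Rightarrow> ('p, 'v) fm set"
  for Atm0 :: "'p set" and Val :: "'v set" where
  Lang_Prop: "p \<in> Atm0 \<Longrightarrow> Atom (Prop p) \<in> Lang Atm0 Val"
| Lang_Dec: "x \<in> Val \<Longrightarrow> Atom (Dec x) \<in> Lang Atm0 Val"
| Lang_Neg: "\<phi> \<in> Lang Atm0 Val \<Longrightarrow> Neg \<phi> \<in> Lang Atm0 Val"
| Lang_Conj: "\<phi> \<in> Lang Atm0 Val \<Longrightarrow> \<psi> \<in> Lang Atm0 Val \<Longrightarrow> Conj \<phi> \<psi> \<in> Lang Atm0 Val"
| Lang_Box: "\<phi> \<in> Lang Atm0 Val \<Longrightarrow> Box b \<phi> \<in> Lang Atm0 Val"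

abbreviation Disj :: "('p, 'v) fm \<Rightarrow> ('p, 'v) fm \<Rightarrow> ('p, 'v) fm" where
  "Disj \<phi> \<psi> \<equiv> Neg (Conj (Neg \<phi>) (Neg \<psi>))"

abbreviation Imp :: "('p, 'v) fm \<Rightarrow> ('p, 'v) fm \<Rightarrow> ('p, 'v) fm" where
  "Imp \<phi> \<psi> \<equiv> Neg (Conj \<phi> (Neg \<psi>))"

abbreviation Iff :: "('p, 'v) fm \<Rightarrow> ('p, 'v) fm \<Rightarrow> ('p, 'v) fm" where
  "Iff \<phi> \<psi> \<equiv> Conj (Imp \<phi> \<psi>) (Imp \<psi> \<phi>)"

(* The grammar has no constant for truth, so it is abbreviated by means of an
   arbitrarily chosen atom of the language. *)
definition Top :: "'p set \<Rightarrow> 'v set \<Rightarrow> ('p, 'v) fm" where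
  "Top Atm0 Val = (let q = Atom (SOME q. q \<in> Atms Atm0 Val) in Neg (Conj q (Neg q)))"

(* Conjunctions and disjunctions over finite index sets are formed along a fixed but
   unspecified enumeration of the index set; the empty ones are Top and Neg Top. *)
definition enum_of :: "'b set \<Rightarrow> 'b list" where
  "enum_of X = (SOME xs. set xs = X \<and> distinct xs)"

definition BigConj :: "'p set \<Rightarrow> 'v set \<Rightarrow> ('b \<Rightarrow> ('p, 'v) fm) \<Rightarrow> 'b set \<Rightarrow> ('p, 'v) fm" where
  "BigConj Atm0 Val f X = foldr (\<lambda>b. Conj (f b)) (enum_of X) (Top Atm0 Val)"

definition BigDisj :: "'p set \<Rightarrow> 'v set \<Rightarrow> ('b \<Rightarrow> ('p, 'v) fm) \<Rightarrow> 'b set \<Rightarrow> ('p, 'v) fm" where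
  "BigDisj Atm0 Val f X = foldr (\<lambda>b. Disj (f b)) (enum_of X) (Neg (Top Atm0 Val))"

definition cn :: "'p set \<Rightarrow> 'v set \<Rightarrow> 'p set \<Rightarrow> 'p set \<Rightarrow> ('p, 'v) fm" where
  "cn Atm0 Val X Y =
     Conj (BigConj Atm0 Val (\<lambda>p. Atom (Prop p)) X)
          (BigConj Atm0 Val (\<lambda>p. Neg (Atom (Prop p))) (Y - X))"

(* Propositional evaluation: atoms and boxed formulas are the propositional variables. *)
primrec prop_eval :: "(('p, 'v) fm \<Rightarrow> bool) \<Rightarrow> ('p, 'v) fm \<Rightarrow> bool" where
  "prop_eval e (Atom q) \<longleftrightarrow> e (Atom q)"
| "prop_eval e (Neg \<phi>) \<longleftrightarrow> \<not> prop_eval e \<phi>"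
| "prop_eval e (Conj \<phi> \<psi>) \<longleftrightarrow> prop_eval e \<phi> \<and> prop_eval e \<psi>"
| "prop_eval e (Box b \<phi>) \<longleftrightarrow> e (Box b \<phi>)"

definition tautology :: "('p, 'v) fm \<Rightarrow> bool" where
  "tautology \<phi> \<longleftrightarrow> (\<forall>e. prop_eval e \<phi>)"

inductive PLC :: "'p set \<Rightarrow> 'v set \<Rightarrow> ('p, 'v) fm \<Rightarrow> bool"
  for Atm0 :: "'p set" and Val :: "'v set" where
  PLC_Taut: "\<phi> \<in> Lang Atm0 Val \<Longrightarrow> tautology \<phi> \<Longrightarrow> PLC Atm0 Val \<phi>"
| PLC_K: "\<phi> \<in> Lang Atm0 Val \<Longrightarrow> \<psi> \<in> Lang Atm0 Val \<Longrightarrow>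
    PLC Atm0 Val (Imp (Conj (Box b \<phi>) (Box b (Imp \<phi> \<psi>))) (Box b \<psi>))"
| PLC_T: "\<phi> \<in> Lang Atm0 Val \<Longrightarrow> PLC Atm0 Val (Imp (Box b \<phi>) \<phi>)"
| PLC_4: "\<phi> \<in> Lang Atm0 Val \<Longrightarrow> PLC Atm0 Val (Imp (Box b \<phi>) (Box b (Box b \<phi>)))"
| PLC_5: "\<phi> \<in> Lang Atm0 Val \<Longrightarrow>
    PLC Atm0 Val (Imp (Neg (Box b \<phi>)) (Box b (Neg (Box b \<phi>))))"
| PLC_Comm: "\<phi> \<in> Lang Atm0 Val \<Longrightarrow>
    PLC Atm0 Val (Iff (Box MF (Box MI \<phi>)) (Box MI (Box MF \<phi>)))"
| PLC_AtLeast: "PLC Atm0 Val (BigDisj Atm0 Val (\<lambda>x. Atom (Dec x)) Val)"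
| PLC_AtMost: "x \<in> Val \<Longrightarrow> y \<in> Val \<Longrightarrow> x \<noteq> y \<Longrightarrow>
    PLC Atm0 Val (Imp (Atom (Dec x)) (Neg (Atom (Dec y))))"
| PLC_Funct: "X \<subseteq> Atm0 \<Longrightarrow> x \<in> Val \<Longrightarrow>
    PLC Atm0 Val (Imp (Conj (cn Atm0 Val X Atm0) (Atom (Dec x)))
                      (Box MI (Imp (cn Atm0 Val X Atm0) (Atom (Dec x)))))"
| PLC_Indep_pos: "p \<in> Atm0 \<Longrightarrow>
    PLC Atm0 Val (Imp (Atom (Prop p)) (Box MF (Atom (Prop p))))"
| PLC_Indep_neg: "p \<in> Atm0 \<Longrightarrow>
    PLC Atm0 Val (Imp (Neg (Atom (Prop p))) (Box MF (Neg (Atom (Prop p)))))"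
| PLC_MP: "PLC Atm0 Val \<phi> \<Longrightarrow> PLC Atm0 Val (Imp \<phi> \<psi>) \<Longrightarrow> PLC Atm0 Val \<psi>"
| PLC_Nec: "PLC Atm0 Val \<phi> \<Longrightarrow> PLC Atm0 Val (Box b \<phi>)"

record ('w, 'p, 'v) mdm =
  worlds :: "'w set"
  rel :: "modality \<Rightarrow> ('w \<times> 'w) set"
  val :: "'w \<Rightarrow> ('p, 'v) atom set"

definition is_MDM :: "'p set \<Rightarrow> 'v set \<Rightarrow> ('w, 'p, 'v) mdm \<Rightarrow> bool" where
  "is_MDM Atm0 Val M \<longleftrightarrow>
     equiv (worlds M) (rel M MI) \<and>
     equiv (worlds M) (rel M MF) \<and>
     (\<forall>w\<in>worlds M. val M w \<subseteq> Atms Atm0 Val) \<and>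
     rel M MI O rel M MF = rel M MF O rel M MI \<and>
     (\<forall>w\<in>worlds M. \<forall>v\<in>worlds M.
        val M w \<inter> Prop ` Atm0 = val M v \<inter> Prop ` Atm0 \<and> (w, v) \<in> rel M MI \<longrightarrow>
        val M w \<inter> Dec ` Val = val M v \<inter> Dec ` Val) \<and>
     (\<forall>w\<in>worlds M. \<forall>v\<in>worlds M.
        (w, v) \<in> rel M MF \<longrightarrow> val M w \<inter> Prop ` Atm0 = val M v \<inter> Prop ` Atm0) \<and>
     (\<forall>w\<in>worlds M. \<forall>x\<in>Val. \<forall>y\<in>Val. Dec x \<in> val M w \<and> x \<noteq> y \<longrightarrow> Dec y \<notin> val M w) \<and>
     (\<forall>w\<in>worlds M. \<exists>x\<in>Val. Dec x \<in> val M w)"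

primrec sat :: "('w, 'p, 'v) mdm \<Rightarrow> 'w \<Rightarrow> ('p, 'v) fm \<Rightarrow> bool" where
  "sat M w (Atom q) \<longleftrightarrow> q \<in> val M w"
| "sat M w (Neg \<phi>) \<longleftrightarrow> \<not> sat M w \<phi>"
| "sat M w (Conj \<phi> \<psi>) \<longleftrightarrow> sat M w \<phi> \<and> sat M w \<psi>"
| "sat M w (Box b \<phi>) \<longleftrightarrow> (\<forall>v. (w, v) \<in> rel M b \<longrightarrow> sat M v \<phi>)"

definition valid_in :: "('w, 'p, 'v) mdm \<Rightarrow> ('p, 'v) fm \<Rightarrow> bool" where
  "valid_in M \<phi> \<longleftrightarrow> (\<forall>w\<in>worlds M. sat M w \<phi>)"

(* HOL cannot quantify over all types of worlds inside a formula, so validity in the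
   class of all MDMs is relative to a type 'w from which the worlds are drawn. *)
definition MDM_valid :: "'w itself \<Rightarrow> 'p set \<Rightarrow> 'v set \<Rightarrow> ('p, 'v) fm \<Rightarrow> bool" where
  "MDM_valid T Atm0 Val \<phi> \<longleftrightarrow>
     (\<forall>M :: ('w, 'p, 'v) mdm. is_MDM Atm0 Val M \<longrightarrow> valid_in M \<phi>)"

end

theory Submission
  imports Defs "HOL-Library.Countable_Set"
begin

text \<open>
  All frame conditions are canonical: the maximal consistent sets form an MDM in which C1 comes
  from Comm together with the S5 axioms, C2 from Funct and C3 from Indep. This model may be
  uncountable, so it is cut down in the manner of Loewenheim and Skolem to a countable set of
  worlds that contains a witness for every failing boxed subformula and a midpoint for every pair
  in the composed relation. Pulling the model back along a surjection from the infinite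
  type \<open>'w\<close> onto that set gives a countermodel with worlds in \<open>'w\<close>.
\<close>

section \<open>Soundness\<close>

lemma set_enum_of [simp]: "finite X \<Longrightarrow> set (enum_of X) = X"
  unfolding enum_of_def using someI_ex[OF finite_distinct_list[of X]] by blast

lemma prop_eval_Top [simp]: "prop_eval e (Top Atm0 Val)"
  by (simp add: Top_def Let_def)

lemma prop_eval_BigConj [simp]:
  assumes "finite X"
  shows "prop_eval e (BigConj Atm0 Val f X) \<longleftrightarrow> (\<forall>b\<in>X. prop_eval e (f b))"
proof -
  have "prop_eval e (foldr (\<lambda>b. Conj (f b)) xs (Top Atm0 Val)) \<longleftrightarrow> (\<forall>b\<in>set xs. prop_eval e (f b))"
    for xs by (induction xs) auto
  then show ?thesis using assms by (simp add: BigConj_def)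
qed

lemma prop_eval_BigDisj [simp]:
  assumes "finite X"
  shows "prop_eval e (BigDisj Atm0 Val f X) \<longleftrightarrow> (\<exists>b\<in>X. prop_eval e (f b))"
proof -
  have "prop_eval e (foldr (\<lambda>b. Disj (f b)) xs (Neg (Top Atm0 Val)))
      \<longleftrightarrow> (\<exists>b\<in>set xs. prop_eval e (f b))"
    for xs by (induction xs) auto
  then show ?thesis using assms by (simp add: BigDisj_def)
qed

lemma prop_eval_cn [simp]:
  assumes "finite X" "finite Y"
  shows "prop_eval e (cn Atm0 Val X Y) \<longleftrightarrow>
    (\<forall>p\<in>X. e (Atom (Prop p))) \<and> (\<forall>p\<in>Y - X. \<not> e (Atom (Prop p)))"
  using assms by (simp add: cn_def)

text \<open>Truth at a world is itself a propositional valuation with boxed formulas as atoms, so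
  tautologies and the evaluation rules for \<open>BigDisj\<close> and \<open>cn\<close> carry over
  to \<open>sat\<close>.\<close>

lemma sat_conv_prop_eval: "sat M w \<phi> \<longleftrightarrow> prop_eval (sat M w) \<phi>"
  by (induction \<phi>) auto

section \<open>Frame conditions of an MDM in usable form, and soundness\<close>

lemma is_MDM_rel:
  assumes "is_MDM Atm0 Val M"
  shows "equiv (worlds M) (rel M b)" and "rel M b O rel M c = rel M c O rel M b"
proof -
  have "equiv (worlds M) (rel M MI) \<and> equiv (worlds M) (rel M MF) \<and>
      rel M MI O rel M MF = rel M MF O rel M MI"
    using assms unfolding is_MDM_def by (elim conjE, intro conjI)
  then show "equiv (worlds M) (rel M b)" "rel M b O rel M c = rel M c O rel M b"
    by (cases b; cases c; simp)+
qed

lemma is_MDM_relD: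
  assumes M: "is_MDM Atm0 Val M"
  shows "(w, v) \<in> rel M b \<Longrightarrow> w \<in> worlds M \<and> v \<in> worlds M"
    and "w \<in> worlds M \<Longrightarrow> (w, w) \<in> rel M b"
    and "(w, v) \<in> rel M b \<Longrightarrow> (v, w) \<in> rel M b"
    and "(w, v) \<in> rel M b \<Longrightarrow> (v, u) \<in> rel M b \<Longrightarrow> (w, u) \<in> rel M b"
  using equiv_type[OF is_MDM_rel(1)[OF M]] equivE[OF is_MDM_rel(1)[OF M]]
  by (blast dest: refl_onD symD transD)+

lemma is_MDM_Dec_eq:
  assumes M: "is_MDM Atm0 Val M" and wv: "(w, v) \<in> rel M MI"
    and eq: "val M w \<inter> Prop ` Atm0 = val M v \<inter> Prop ` Atm0"
  shows "val M w \<inter> Dec ` Val = val M v \<inter> Dec ` Val"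
proof -
  have "\<forall>w\<in>worlds M. \<forall>v\<in>worlds M.
      val M w \<inter> Prop ` Atm0 = val M v \<inter> Prop ` Atm0 \<and> (w, v) \<in> rel M MI \<longrightarrow>
      val M w \<inter> Dec ` Val = val M v \<inter> Dec ` Val"
    using M unfolding is_MDM_def by (elim conjE)
  then show ?thesis using wv eq is_MDM_relD(1)[OF M wv] by metis
qed

lemma is_MDM_Prop_iff:
  assumes M: "is_MDM Atm0 Val M" and wv: "(w, v) \<in> rel M MF" and p: "p \<in> Atm0"
  shows "Prop p \<in> val M w \<longleftrightarrow> Prop p \<in> val M v"
proof -
  have "\<forall>w\<in>worlds M. \<forall>v\<in>worlds M.
      (w, v) \<in> rel M MF \<longrightarrow> val M w \<inter> Prop ` Atm0 = val M v \<inter> Prop ` Atm0"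
    using M unfolding is_MDM_def by (elim conjE)
  then have "val M w \<inter> Prop ` Atm0 = val M v \<inter> Prop ` Atm0"
    using wv is_MDM_relD(1)[OF M wv] by metis
  then show ?thesis using p by blast
qed

lemma PLC_sound:
  fixes M :: "('w, 'p, 'v) mdm"
  assumes "PLC Atm0 Val \<phi>" and fin: "finite Atm0" "finite Val"
    and M: "is_MDM Atm0 Val M"
  shows "w \<in> worlds M \<Longrightarrow> sat M w \<phi>"
  using assms(1)
proof (induction arbitrary: w rule: PLC.induct)
  case (PLC_Taut \<phi>)
  then show ?case by (metis sat_conv_prop_eval tautology_def)
next
  case (PLC_T \<phi> b)
  then show ?case using is_MDM_relD(2)[OF M, of w b] by auto
next
  case (PLC_4 \<phi> b)
  have "(w, u) \<in> rel M b" if "(w, v) \<in> rel M b" "(v, u) \<in> rel M b" for v u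
    using is_MDM_relD(4)[OF M that] .
  then show ?case by simp blast
next
  case (PLC_5 \<phi> b)
  have "(v, u) \<in> rel M b" if "(w, v) \<in> rel M b" "(w, u) \<in> rel M b" for v u
    using is_MDM_relD(4)[OF M is_MDM_relD(3)[OF M that(1)] that(2)] .
  then show ?case by simp blast
next
  case (PLC_Comm \<phi>)
  \<comment> \<open>Two nested boxes quantify over the composed relation, which turns Comm into
    C1.\<close>
  have "sat M w (Box b (Box c \<phi>)) \<longleftrightarrow> (\<forall>v. (w, v) \<in> rel M b O rel M c \<longrightarrow> sat M v \<phi>)" for b c
    by auto
  then have "sat M w (Box MF (Box MI \<phi>)) \<longleftrightarrow> sat M w (Box MI (Box MF \<phi>))"
    using is_MDM_rel(2)[OF M, of MF MI] by simp
  then show ?case by (simp only: sat.simps) blast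
next
  case PLC_AtLeast
  moreover have "\<exists>x\<in>Val. Dec x \<in> val M w"
    using M PLC_AtLeast by (simp add: is_MDM_def)
  ultimately show ?case
    using fin by (simp add: sat_conv_prop_eval[of _ _ "BigDisj _ _ _ _"])
next
  case (PLC_AtMost x y)
  have "\<forall>w\<in>worlds M. \<forall>x\<in>Val. \<forall>y\<in>Val. Dec x \<in> val M w \<and> x \<noteq> y \<longrightarrow> Dec y \<notin> val M w"
    using M unfolding is_MDM_def by (elim conjE)
  then have "Dec x \<in> val M w \<longrightarrow> Dec y \<notin> val M w" using PLC_AtMost by blast
  then show ?case by simp
next
  case (PLC_Funct X x)
  have "finite X" using PLC_Funct.hyps fin finite_subset by blast
  \<comment> \<open>\<open>cn\<close> fixes the truth value of every atom in \<open>Atm0\<close>, so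
    two worlds satisfying it agree on all inputs, as C2 requires.\<close>
  then have cn: "sat M u (cn Atm0 Val X Atm0) \<longleftrightarrow>
      (\<forall>p\<in>X. Prop p \<in> val M u) \<and> (\<forall>p\<in>Atm0 - X. Prop p \<notin> val M u)" for u
    using fin by (simp add: sat_conv_prop_eval[of _ _ "cn _ _ _ _"])
  have "Dec x \<in> val M v"
    if "(w, v) \<in> rel M MI" "sat M w (cn Atm0 Val X Atm0)" "Dec x \<in> val M w"
      "sat M v (cn Atm0 Val X Atm0)" for v
  proof -
    have "val M w \<inter> Prop ` Atm0 = val M v \<inter> Prop ` Atm0"
      using that(2,4) unfolding cn by blast
    then have "val M w \<inter> Dec ` Val = val M v \<inter> Dec ` Val"
      by (rule is_MDM_Dec_eq[OF M that(1)])
    then show ?thesis using that(3) PLC_Funct.hyps by blast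
  qed
  then show ?case by auto
next
  case (PLC_Indep_pos p)
  then show ?case using is_MDM_Prop_iff[OF M] by simp blast
next
  case (PLC_Indep_neg p)
  then show ?case using is_MDM_Prop_iff[OF M] by simp blast
next
  case (PLC_Nec \<phi> b)
  have "v \<in> worlds M" if "(w, v) \<in> rel M b" for v
    using is_MDM_relD(1)[OF M that] by blast
  then show ?case using PLC_Nec.IH by simp
qed auto

section \<open>Maximal consistent sets\<close>

inductive_simps Lang_simps [simp]:
  "Atom (Prop p) \<in> Lang Atm0 Val"
  "Atom (Dec x) \<in> Lang Atm0 Val"
  "Neg \<phi> \<in> Lang Atm0 Val"
  "Conj \<phi> \<psi> \<in> Lang Atm0 Val"
  "Box b \<phi> \<in> Lang Atm0 Val"

lemma Atom_in_Lang_iff [simp]: "Atom q \<in> Lang Atm0 Val \<longleftrightarrow> q \<in> Atms Atm0 Val"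
  by (cases q) auto

text \<open>\<open>Top\<close> is built from a chosen atom and lies in the language only if there is
  one; the formula under consideration supplies it.\<close>

lemma Lang_imp_Atms_nonempty: "\<phi> \<in> Lang Atm0 Val \<Longrightarrow> Atms Atm0 Val \<noteq> {}"
  by (induction rule: Lang.induct) auto

abbreviation Imps :: "('p, 'v) fm list \<Rightarrow> ('p, 'v) fm \<Rightarrow> ('p, 'v) fm" where
  "Imps xs \<phi> \<equiv> foldr Imp xs \<phi>"

lemma prop_eval_Imps [simp]:
  "prop_eval e (Imps xs \<phi>) \<longleftrightarrow> ((\<forall>\<chi>\<in>set xs. prop_eval e \<chi>) \<longrightarrow> prop_eval e \<phi>)"
  by (induction xs) auto

lemma Imps_in_Lang [simp]:
  "Imps xs \<phi> \<in> Lang Atm0 Val \<longleftrightarrow> set xs \<subseteq> Lang Atm0 Val \<and> \<phi> \<in> Lang Atm0 Val"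
  by (induction xs) auto

locale plc =
  fixes Atm0 :: "'p set" and Val :: "'v set"
  assumes finite_Atm0: "finite Atm0" and finite_Val: "finite Val"
    and Atms_nonempty: "Atms Atm0 Val \<noteq> {}"
begin

abbreviation "L \<equiv> Lang Atm0 Val"
abbreviation "thm_of \<equiv> PLC Atm0 Val"
abbreviation "Falsum \<equiv> Neg (Top Atm0 Val)"

lemma Top_in_Lang [simp]: "Top Atm0 Val \<in> L"
  using some_in_eq[of "Atms Atm0 Val"] Atms_nonempty by (simp add: Top_def Let_def)

lemma BigConj_in_Lang [simp]:
  assumes "finite X" "\<And>b. b \<in> X \<Longrightarrow> f b \<in> L"
  shows "BigConj Atm0 Val f X \<in> L"
proof -
  have "set xs \<subseteq> X \<Longrightarrow> foldr (\<lambda>b. Conj (f b)) xs (Top Atm0 Val) \<in> L" for xs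
    by (induction xs) (use assms in auto)
  then show ?thesis using assms by (simp add: BigConj_def)
qed

lemma BigDisj_in_Lang [simp]:
  assumes "finite X" "\<And>b. b \<in> X \<Longrightarrow> f b \<in> L"
  shows "BigDisj Atm0 Val f X \<in> L"
proof -
  have "set xs \<subseteq> X \<Longrightarrow> foldr (\<lambda>b. Disj (f b)) xs (Neg (Top Atm0 Val)) \<in> L" for xs
    by (induction xs) (use assms in auto)
  then show ?thesis using assms by (simp add: BigDisj_def)
qed

lemma cn_in_Lang [simp]: "X \<subseteq> Atm0 \<Longrightarrow> cn Atm0 Val X Atm0 \<in> L"
  using finite_Atm0 finite_subset[of X Atm0] by (auto simp: cn_def intro!: BigConj_in_Lang)

lemma PLC_in_Lang: "thm_of \<phi> \<Longrightarrow> \<phi> \<in> L"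
  by (induction rule: PLC.induct) (auto simp: finite_Val)

text \<open>The premises are discharged into one theorem, so necessitation applies to theorems only,
  never to premises.\<close>

definition derives :: "('p, 'v) fm set \<Rightarrow> ('p, 'v) fm \<Rightarrow> bool" where
  "derives S \<phi> \<longleftrightarrow> (\<exists>xs. set xs \<subseteq> S \<and> thm_of (Imps xs \<phi>))"

lemma derives_in_Lang: "derives S \<phi> \<Longrightarrow> \<phi> \<in> L"
  unfolding derives_def using PLC_in_Lang by fastforce

text \<open>Replaces propositional derivations inside the calculus by a check over all valuations
  \<open>e\<close>.\<close>

lemma PLC_taut_MP:
  assumes "thm_of \<phi>" "\<psi> \<in> L" "\<And>e. prop_eval e \<phi> \<Longrightarrow> prop_eval e \<psi>"
  shows "thm_of \<psi>"
proof (rule PLC_MP[OF assms(1) PLC_Taut])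
  show "Imp \<phi> \<psi> \<in> L" using assms PLC_in_Lang by auto
  show "tautology (Imp \<phi> \<psi>)" using assms(3) by (auto simp: tautology_def)
qed

lemma derives_taut:
  assumes "set xs \<subseteq> S" "S \<subseteq> L" "\<phi> \<in> L" "\<And>e. (\<forall>\<chi>\<in>set xs. prop_eval e \<chi>) \<Longrightarrow> prop_eval e \<phi>"
  shows "derives S \<phi>"
proof -
  have "thm_of (Imps xs \<phi>)"
    by (rule PLC_Taut) (use assms in \<open>auto simp: tautology_def\<close>)
  then show ?thesis using assms(1) derives_def by blast
qed

lemma derives_PLC: "thm_of \<phi> \<Longrightarrow> derives S \<phi>"
  unfolding derives_def by (rule exI[of _ "[]"]) simp

text \<open>Concatenating the two premise lists leaves a purely propositional step. When only one
  derivation is at hand it is passed twice.\<close>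

lemma derives_cut:
  assumes "derives S \<phi>" "derives S \<psi>" "\<chi> \<in> L"
    and "\<And>e. prop_eval e \<phi> \<Longrightarrow> prop_eval e \<psi> \<Longrightarrow> prop_eval e \<chi>"
  shows "derives S \<chi>"
proof -
  obtain xs ys where xs: "set xs \<subseteq> S" "thm_of (Imps xs \<phi>)" and ys: "set ys \<subseteq> S" "thm_of (Imps ys \<psi>)"
    using assms(1,2) derives_def by auto
  have L: "set xs \<subseteq> L" "set ys \<subseteq> L" "\<phi> \<in> L" "\<psi> \<in> L"
    using PLC_in_Lang[OF xs(2)] PLC_in_Lang[OF ys(2)] by auto
  have "thm_of (Imp (Imps ys \<psi>) (Imps (xs @ ys) \<chi>))"
    by (rule PLC_taut_MP[OF xs(2)]) (use L assms(3,4) in auto)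
  from PLC_MP[OF ys(2) this] show ?thesis
    using xs(1) ys(1) unfolding derives_def by (intro exI[of _ "xs @ ys"]) auto
qed

text \<open>A deduction theorem for many premises at once: those outside \<open>A\<close> move into
  the conclusion.\<close>

lemma derives_union:
  assumes "derives (A \<union> B) \<phi>"
  obtains ys where "set ys \<subseteq> B" "set ys \<subseteq> L" "derives A (Imps ys \<phi>)"
proof -
  obtain xs where xs: "set xs \<subseteq> A \<union> B" "thm_of (Imps xs \<phi>)"
    using assms derives_def by auto
  let ?as = "filter (\<lambda>x. x \<in> A) xs" and ?bs = "filter (\<lambda>x. x \<notin> A) xs"
  have L: "set xs \<subseteq> L" "\<phi> \<in> L" using PLC_in_Lang[OF xs(2)] by auto
  have "thm_of (Imps ?as (Imps ?bs \<phi>))"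
    by (rule PLC_taut_MP[OF xs(2)]) (use L in auto)
  then have "derives A (Imps ?bs \<phi>)"
    unfolding derives_def by (intro exI[of _ ?as]) auto
  then show thesis using that[of ?bs] xs(1) L by auto
qed

lemma derives_insert:
  assumes "derives (insert \<chi> A) \<phi>" "\<chi> \<in> L"
  shows "derives A (Imp \<chi> \<phi>)"
proof -
  from assms(1) have "derives (A \<union> {\<chi>}) \<phi>" by simp
  then obtain ys where ys: "set ys \<subseteq> {\<chi>}" "derives A (Imps ys \<phi>)"
    by (rule derives_union)
  show ?thesis
    by (rule derives_cut[OF ys(2) ys(2)]) (use ys assms(2) derives_in_Lang[OF assms(1)] in auto)
qed

section \<open>Consistency and Lindenbaum's lemma\<close>

definition consistent :: "('p, 'v) fm set \<Rightarrow> bool" where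
  "consistent S \<longleftrightarrow> S \<subseteq> L \<and> \<not> derives S Falsum"

definition mcs :: "('p, 'v) fm set \<Rightarrow> bool" where
  "mcs S \<longleftrightarrow> consistent S \<and> (\<forall>\<phi>\<in>L. \<phi> \<in> S \<or> Neg \<phi> \<in> S)"

lemma lindenbaum:
  assumes "consistent S"
  obtains T where "S \<subseteq> T" "mcs T"
proof -
  let ?C = "{T. S \<subseteq> T \<and> consistent T}"
  have "\<exists>T\<in>?C. \<forall>X\<in>?C. T \<subseteq> X \<longrightarrow> X = T"
  proof (rule subset_Zorn_nonempty)
    show "?C \<noteq> {}" using assms by auto
  next
    fix C assume C: "C \<noteq> {}" "subset.chain ?C C"
    then have elem: "T \<in> C \<Longrightarrow> S \<subseteq> T \<and> consistent T" for T
      by (auto simp: subset.chain_def)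
    have "\<not> derives (\<Union>C) Falsum"
    proof
      assume "derives (\<Union>C) Falsum"
      then obtain xs where xs: "set xs \<subseteq> \<Union>C" "thm_of (Imps xs Falsum)"
        using derives_def by auto
      \<comment> \<open>A derivation uses finitely many premises, so a single member of the chain
        contains them all.\<close>
      then obtain T where "T \<in> C" "set xs \<subseteq> T"
        using finite_subset_Union_chain[OF _ xs(1) C] by blast
      then show False using elem xs(2) unfolding consistent_def derives_def by blast
    qed
    moreover have "S \<subseteq> \<Union>C" "\<Union>C \<subseteq> L" using C(1) elem unfolding consistent_def by blast+
    ultimately show "\<Union>C \<in> ?C" by (auto simp: consistent_def)
  qed
  then obtain T where "T \<in> ?C" and "\<forall>X\<in>?C. T \<subseteq> X \<longrightarrow> X = T"
    by (rule bexE)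
  then have T: "S \<subseteq> T" "consistent T"
    and "\<forall>X\<in>?C. T \<subseteq> X \<longrightarrow> X = T"
    by simp_all
  then have max: "S \<subseteq> X \<Longrightarrow> consistent X \<Longrightarrow> T \<subseteq> X \<Longrightarrow> X = T" for X
    by simp
  have "\<phi> \<in> T \<or> Neg \<phi> \<in> T" if "\<phi> \<in> L" for \<phi>
  proof (rule ccontr)
    assume no: "\<not> (\<phi> \<in> T \<or> Neg \<phi> \<in> T)"
    have TL: "T \<subseteq> L" using T(2) consistent_def by blast
    \<comment> \<open>By maximality any formula outside \<open>T\<close> is refuted by
      \<open>T\<close>; refuting both \<open>\<phi>\<close> and its negation makes \<open>T\<close>
      inconsistent.\<close>
    have d: "derives T (Imp \<psi> Falsum)" if "\<psi> \<in> L" "\<psi> \<notin> T" for \<psi>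
    proof -
      have "insert \<psi> T \<noteq> T" using that(2) by blast
      then have "\<not> consistent (insert \<psi> T)" using max[of "insert \<psi> T"] T(1) by blast
      then have "derives (insert \<psi> T) Falsum" using TL that(1) by (simp add: consistent_def)
      then show ?thesis using that(1) by (rule derives_insert)
    qed
    have "derives T Falsum"
      by (rule derives_cut[OF d[of \<phi>] d[of "Neg \<phi>"]]) (use no that in auto)
    then show False using T(2) consistent_def by blast
  qed
  then have "mcs T" using T(2) by (simp add: mcs_def)
  then show thesis using that T(1) by blast
qed

section \<open>Closure properties of maximal consistent sets\<close>

lemma mcs_in_Lang: "mcs S \<Longrightarrow> \<phi> \<in> S \<Longrightarrow> \<phi> \<in> L"
  unfolding mcs_def consistent_def by blast

lemma mcs_derives:
  assumes "mcs S" "derives S \<phi>"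
  shows "\<phi> \<in> S"
proof (rule ccontr)
  assume "\<phi> \<notin> S"
  then have n: "Neg \<phi> \<in> S" using assms derives_in_Lang mcs_def by blast
  have "S \<subseteq> L" using assms(1) mcs_in_Lang by blast
  then have "derives S (Neg \<phi>)"
    by (intro derives_taut[of "[Neg \<phi>]"]) (use n in auto)
  from derives_cut[OF assms(2) this, of Falsum] have "derives S Falsum" by auto
  then show False using assms(1) mcs_def consistent_def by blast
qed

lemma mcs_taut:
  assumes "mcs S" "set xs \<subseteq> S" "\<phi> \<in> L" "\<And>e. (\<forall>\<chi>\<in>set xs. prop_eval e \<chi>) \<Longrightarrow> prop_eval e \<phi>"
  shows "\<phi> \<in> S"
  using assms derives_taut[of xs S \<phi>] mcs_derives mcs_in_Lang by blast

lemma mcs_PLC: "mcs S \<Longrightarrow> thm_of \<phi> \<Longrightarrow> \<phi> \<in> S"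
  using derives_PLC mcs_derives by blast

lemma mcs_Neg:
  assumes "mcs S" "\<phi> \<in> L"
  shows "Neg \<phi> \<in> S \<longleftrightarrow> \<phi> \<notin> S"
proof
  assume n: "Neg \<phi> \<in> S"
  show "\<phi> \<notin> S"
  proof
    assume "\<phi> \<in> S"
    then have "Falsum \<in> S" using n assms by (intro mcs_taut[of S "[\<phi>, Neg \<phi>]"]) auto
    then have "derives S Falsum"
      by (intro derives_taut[of "[Falsum]"]) (use assms mcs_in_Lang in auto)
    then show False using assms(1) mcs_def consistent_def by blast
  qed
qed (use assms mcs_def in blast)

lemma mcs_Conj:
  assumes "mcs S"
  shows "Conj \<phi> \<psi> \<in> S \<longleftrightarrow> \<phi> \<in> S \<and> \<psi> \<in> S"
proof (intro iffI conjI)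
  assume c: "Conj \<phi> \<psi> \<in> S"
  then have "Conj \<phi> \<psi> \<in> L" using assms mcs_in_Lang by blast
  then show "\<phi> \<in> S" "\<psi> \<in> S"
    using c assms by (auto intro: mcs_taut[of S "[Conj \<phi> \<psi>]"])
next
  assume "\<phi> \<in> S \<and> \<psi> \<in> S"
  then show "Conj \<phi> \<psi> \<in> S"
    by (intro mcs_taut[of S "[\<phi>, \<psi>]"]) (use assms mcs_in_Lang in auto)
qed

text \<open>Membership in \<open>S\<close> acts as a valuation, so \<open>cn\<close> and
  \<open>BigDisj\<close> can be handled through their evaluation rules without unfolding the
  enumeration.\<close>

lemma mcs_prop_eval:
  assumes "mcs S" "\<phi> \<in> L"
  shows "prop_eval (\<lambda>\<psi>. \<psi> \<in> S) \<phi> \<longleftrightarrow> \<phi> \<in> S"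
  using assms(2) by (induction \<phi>) (use assms(1) mcs_Neg mcs_Conj in auto)

lemma mcs_MP:
  assumes "mcs S" "Imp \<phi> \<psi> \<in> S" "\<phi> \<in> S"
  shows "\<psi> \<in> S"
proof -
  have "Imp \<phi> \<psi> \<in> L" using assms mcs_in_Lang by blast
  then show ?thesis
    using assms by (intro mcs_taut[of S "[Imp \<phi> \<psi>, \<phi>]"]) auto
qed

lemma mcs_PLC_MP: "mcs S \<Longrightarrow> thm_of (Imp \<phi> \<psi>) \<Longrightarrow> \<phi> \<in> S \<Longrightarrow> \<psi> \<in> S"
  using mcs_MP mcs_PLC by blast

lemma mcs_Box_K:
  assumes "mcs S" "Box b (Imp \<phi> \<psi>) \<in> S" "Box b \<phi> \<in> S"
  shows "Box b \<psi> \<in> S"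
proof -
  have "Box b (Imp \<phi> \<psi>) \<in> L" using assms mcs_in_Lang by blast
  then have "thm_of (Imp (Conj (Box b \<phi>) (Box b (Imp \<phi> \<psi>))) (Box b \<psi>))"
    by (intro PLC_K) auto
  then show ?thesis using assms mcs_PLC_MP mcs_Conj by blast
qed

text \<open>The theorem \<open>Imps xs \<phi>\<close> is necessitated, and K then peels off the
  boxed premises one by one.\<close>

lemma mcs_Box_derives:
  assumes "mcs S" "derives {\<psi>. Box b \<psi> \<in> S} \<phi>"
  shows "Box b \<phi> \<in> S"
proof -
  obtain xs where xs: "set xs \<subseteq> {\<psi>. Box b \<psi> \<in> S}" "thm_of (Imps xs \<phi>)"
    using assms(2) derives_def by auto
  \<comment> \<open>Necessitation gives the boxed implication for the full list only, so the
    induction on \<open>xs\<close> takes it as an assumption.\<close>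
  have "Box b (Imps xs \<phi>) \<in> S \<Longrightarrow> Box b \<phi> \<in> S"
    using xs(1)
  proof (induction xs)
    case (Cons \<chi> xs)
    then show ?case using mcs_Box_K[OF assms(1), of b \<chi> "Imps xs \<phi>"] by simp
  qed simp
  then show ?thesis using mcs_PLC[OF assms(1) PLC_Nec[OF xs(2)]] by blast
qed

lemma mcs_unbox_in_Lang: "mcs S \<Longrightarrow> Box b \<psi> \<in> S \<Longrightarrow> \<psi> \<in> L"
  using mcs_in_Lang by fastforce

lemma unbox_in_Lang: "mcs S \<Longrightarrow> {\<psi>. Box b \<psi> \<in> S} \<subseteq> L"
  using mcs_unbox_in_Lang by blast

lemma mcs_Box_mono:
  assumes "mcs S" "Box b \<phi> \<in> S" "thm_of (Imp \<phi> \<psi>)"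
  shows "Box b \<psi> \<in> S"
  using assms mcs_Box_K mcs_PLC PLC_Nec by blast

section \<open>The canonical model\<close>

text \<open>The relations demand only that unboxing leads from \<open>S\<close> into
  \<open>T\<close>; axioms T, 5 and 4 make them reflexive, symmetric and transitive.\<close>

definition canonical :: "(('p, 'v) fm set, 'p, 'v) mdm" where
  "canonical = \<lparr>worlds = {S. mcs S},
     rel = (\<lambda>b. {(S, T). mcs S \<and> mcs T \<and> (\<forall>\<psi>. Box b \<psi> \<in> S \<longrightarrow> \<psi> \<in> T)}),
     val = (\<lambda>S. {q. Atom q \<in> S})\<rparr>"

abbreviation "R \<equiv> rel canonical"

lemma worlds_canonical [simp]: "worlds canonical = {S. mcs S}"
  and R_iff: "(S, T) \<in> R b \<longleftrightarrow> mcs S \<and> mcs T \<and> (\<forall>\<psi>. Box b \<psi> \<in> S \<longrightarrow> \<psi> \<in> T)"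
  and val_canonical [simp]: "val canonical S = {q. Atom q \<in> S}"
  by (auto simp: canonical_def)

lemma R_I: "mcs S \<Longrightarrow> mcs T \<Longrightarrow> (\<And>\<psi>. Box b \<psi> \<in> S \<Longrightarrow> \<psi> \<in> T) \<Longrightarrow> (S, T) \<in> R b"
  and R_Box: "(S, T) \<in> R b \<Longrightarrow> Box b \<psi> \<in> S \<Longrightarrow> \<psi> \<in> T"
  and R_mcs: "(S, T) \<in> R b \<Longrightarrow> mcs S" "(S, T) \<in> R b \<Longrightarrow> mcs T"
  unfolding R_iff by blast+

section \<open>Equivalence and commutation of the canonical relations\<close>

lemma R_refl:
  assumes "mcs S"
  shows "(S, S) \<in> R b"
proof (rule R_I[OF assms assms])
  fix \<psi> assume "Box b \<psi> \<in> S"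
  then show "\<psi> \<in> S" using mcs_PLC_MP[OF assms PLC_T] mcs_unbox_in_Lang[OF assms] by blast
qed

lemma R_sym:
  assumes ST: "(S, T) \<in> R b"
  shows "(T, S) \<in> R b"
proof (rule R_I)
  note m = R_mcs[OF ST]
  then show "mcs T" "mcs S" by simp_all
  fix \<psi> assume T: "Box b \<psi> \<in> T"
  show "\<psi> \<in> S"
  proof (rule ccontr)
    assume "\<psi> \<notin> S"
    have L: "\<psi> \<in> L" using mcs_unbox_in_Lang[OF m(2) T] .
    \<comment> \<open>A box absent from \<open>S\<close> is carried by axiom 5 as a boxed negation,
      which then reaches \<open>T\<close> and contradicts the assumption there.\<close>
    have "Box b \<psi> \<notin> S" using R_Box[OF R_refl[OF m(1)]] \<open>\<psi> \<notin> S\<close> by blast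
    then have "Neg (Box b \<psi>) \<in> S" using mcs_Neg[OF m(1)] L by simp
    then have "Box b (Neg (Box b \<psi>)) \<in> S" using mcs_PLC_MP[OF m(1) PLC_5[OF L]] by blast
    then have "Neg (Box b \<psi>) \<in> T" by (rule R_Box[OF ST])
    then show False using T L mcs_Neg[OF m(2), of "Box b \<psi>"] by simp
  qed
qed

lemma R_trans:
  assumes ST: "(S, T) \<in> R b" and TU: "(T, U) \<in> R b"
  shows "(S, U) \<in> R b"
proof (rule R_I[OF R_mcs(1)[OF ST] R_mcs(2)[OF TU]])
  fix \<psi> assume S: "Box b \<psi> \<in> S"
  have "Box b (Box b \<psi>) \<in> S"
    using mcs_PLC_MP[OF R_mcs(1)[OF ST] PLC_4 S] mcs_unbox_in_Lang[OF R_mcs(1)[OF ST] S] by blast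
  then show "\<psi> \<in> U" by (intro R_Box[OF TU] R_Box[OF ST])
qed

text \<open>Leaving \<open>b\<close> and \<open>c\<close> arbitrary covers both directions of Comm;
  the case of equal modalities is trivial.\<close>

lemma mcs_Box_commute:
  assumes "mcs S" "Box b (Box c \<phi>) \<in> S"
  shows "Box c (Box b \<phi>) \<in> S"
proof -
  have "\<phi> \<in> L" using mcs_in_Lang[OF assms] by simp
  then have "Iff (Box MF (Box MI \<phi>)) (Box MI (Box MF \<phi>)) \<in> S"
    using mcs_PLC[OF assms(1) PLC_Comm] by blast
  then have "Imp (Box MF (Box MI \<phi>)) (Box MI (Box MF \<phi>)) \<in> S"
    "Imp (Box MI (Box MF \<phi>)) (Box MF (Box MI \<phi>)) \<in> S"
    using mcs_Conj[OF assms(1)] by blast+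
  then show ?thesis using assms mcs_MP by (cases b; cases c) blast+
qed

text \<open>The derivable principle behind this step is \<open>\<langle>c\<rangle>\<box>\<^sub>b \<chi> \<longrightarrow> \<box>\<^sub>b\<langle>c\<rangle> \<chi>\<close>.\<close>

lemma R_confluent_Box:
  assumes SU: "(S, U) \<in> R b" and UT: "(U, T) \<in> R c" and box: "Box b \<chi> \<in> T"
  shows "Box c (Neg \<chi>) \<notin> S"
proof
  assume contra: "Box c (Neg \<chi>) \<in> S"
  note m = R_mcs(1)[OF SU] R_mcs[OF UT]
  have L: "\<chi> \<in> L" using mcs_unbox_in_Lang[OF m(3) box] .
  \<comment> \<open>\<open>?d\<close> is the \<open>c\<close>-diamond of \<open>\<chi>\<close>. T
    gives \<open>\<chi>\<close> implies \<open>?d\<close>, and 5 gives \<open>?d\<close> implies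
    \<open>Box c ?d\<close>; hence \<open>Box b (Box c ?d)\<close> is in \<open>T\<close>. After
    commuting the boxes, \<open>c\<close> leads back to \<open>U\<close> and \<open>b\<close> back
    to \<open>S\<close>.\<close>
  let ?d = "Neg (Box c (Neg \<chi>))"
  have "thm_of (Imp (Box c (Neg \<chi>)) (Neg \<chi>))" using L by (intro PLC_T) auto
  then have "thm_of (Imp \<chi> ?d)" by (rule PLC_taut_MP) (use L in auto)
  then have "Box b ?d \<in> T" using mcs_Box_mono m box by blast
  moreover have "thm_of (Imp ?d (Box c ?d))" using L by (intro PLC_5) auto
  ultimately have "Box b (Box c ?d) \<in> T" using mcs_Box_mono m by blast
  then have "Box c (Box b ?d) \<in> T" using mcs_Box_commute m by blast
  then have "Box b ?d \<in> U" by (rule R_Box[OF R_sym[OF UT]])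
  then have "?d \<in> S" by (rule R_Box[OF R_sym[OF SU]])
  then show False using contra m L mcs_Neg[of S "Box c (Neg \<chi>)"] by auto
qed

text \<open>The new midpoint extends the formulas boxed by \<open>c\<close> at \<open>S\<close>
  together with those boxed by \<open>b\<close> at \<open>T\<close>. As \<open>b\<close> and
  \<open>c\<close> are arbitrary, the inclusion yields the equality C1.\<close>

lemma R_commute: "R b O R c \<subseteq> R c O R b"
proof clarify
  fix S U T assume SU: "(S, U) \<in> R b" and UT: "(U, T) \<in> R c"
  note m = R_mcs(1)[OF SU] R_mcs[OF UT]
  let ?A = "{\<psi>. Box c \<psi> \<in> S}" and ?B = "{\<psi>. Box b \<psi> \<in> T}"
  have "consistent (?A \<union> ?B)"
    unfolding consistent_def
  proof
    show "\<not> derives (?A \<union> ?B) Falsum"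
    proof
      assume "derives (?A \<union> ?B) Falsum"
      then obtain ys where ys: "set ys \<subseteq> ?B" "set ys \<subseteq> L" "derives ?A (Imps ys Falsum)"
        by (rule derives_union)
      \<comment> \<open>\<open>?\<chi>\<close> is equivalent to the conjunction of
        \<open>ys\<close>: \<open>?B\<close> derives it while \<open>?A\<close> derives its
        negation, which the previous lemma excludes.\<close>
      let ?\<chi> = "Neg (Imps ys Falsum)"
      have "derives ?B ?\<chi>"
        by (rule derives_taut[OF ys(1) unbox_in_Lang]) (use m ys(2) in auto)
      then have "Box b ?\<chi> \<in> T" using mcs_Box_derives m by blast
      moreover have "derives ?A (Neg ?\<chi>)"
        by (rule derives_cut[OF ys(3) ys(3)]) (use ys(2) in auto)
      then have "Box c (Neg ?\<chi>) \<in> S" using mcs_Box_derives m by blast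
      ultimately show False using R_confluent_Box[OF SU UT] by blast
    qed
    show "?A \<union> ?B \<subseteq> L" using unbox_in_Lang[OF m(1)] unbox_in_Lang[OF m(3)] by simp
  qed
  then obtain U' where "?A \<union> ?B \<subseteq> U'" "mcs U'" by (rule lindenbaum)
  then have "(S, U') \<in> R c" "(T, U') \<in> R b" using m by (auto intro!: R_I)
  then show "(S, T) \<in> R c O R b" using R_sym by blast
qed

text \<open>If \<open>Neg \<phi>\<close> were inconsistent with the formulas boxed at
  \<open>S\<close>, these would derive \<open>\<phi>\<close> and so put \<open>Box b \<phi>\<close>
  into \<open>S\<close>.\<close>

lemma mcs_Box_witness:
  assumes "mcs S" "\<phi> \<in> L" "Box b \<phi> \<notin> S"
  obtains T where "(S, T) \<in> R b" "\<phi> \<notin> T"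
proof -
  let ?A = "{\<psi>. Box b \<psi> \<in> S}"
  have "\<not> derives (insert (Neg \<phi>) ?A) Falsum"
  proof
    assume "derives (insert (Neg \<phi>) ?A) Falsum"
    then have d: "derives ?A (Imp (Neg \<phi>) Falsum)" using derives_insert assms(2) by simp
    have "derives ?A \<phi>" by (rule derives_cut[OF d d]) (use assms(2) in auto)
    then show False using mcs_Box_derives assms by blast
  qed
  then have "consistent (insert (Neg \<phi>) ?A)"
    using unbox_in_Lang[OF assms(1)] assms(2) by (auto simp: consistent_def)
  then obtain T where "insert (Neg \<phi>) ?A \<subseteq> T" "mcs T" by (rule lindenbaum)
  then have "(S, T) \<in> R b" "Neg \<phi> \<in> T" "mcs T" using assms(1) by (auto intro!: R_I)
  then show thesis using that assms(2) mcs_Neg by blast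
qed

lemma truth_lemma:
  assumes "\<phi> \<in> L" "mcs S"
  shows "sat canonical S \<phi> \<longleftrightarrow> \<phi> \<in> S"
  using assms
proof (induction arbitrary: S rule: Lang.induct)
  case (Lang_Neg \<phi>)
  then show ?case using mcs_Neg[of S \<phi>] by simp
next
  case (Lang_Conj \<phi> \<psi>)
  then show ?case using mcs_Conj[of S \<phi> \<psi>] by simp
next
  case (Lang_Box \<phi> b)
  have "sat canonical S (Box b \<phi>) \<longleftrightarrow> (\<forall>T. (S, T) \<in> R b \<longrightarrow> \<phi> \<in> T)"
    using Lang_Box.IH R_mcs(2) by auto
  also have "\<dots> \<longleftrightarrow> Box b \<phi> \<in> S"
  proof
    show "Box b \<phi> \<in> S" if "\<forall>T. (S, T) \<in> R b \<longrightarrow> \<phi> \<in> T"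
    proof (rule ccontr)
      assume "Box b \<phi> \<notin> S"
      then obtain T where "(S, T) \<in> R b" "\<phi> \<notin> T"
        by (rule mcs_Box_witness[OF Lang_Box.prems Lang_Box.hyps])
      then show False using that by blast
    qed
  qed (auto dest: R_Box)
  finally show ?case .
qed simp_all

text \<open>Half of C2, from Funct; symmetry of \<open>R MI\<close> gives the other half.\<close>

lemma canonical_Dec_mono:
  assumes ST: "(S, T) \<in> R MI"
    and eq: "val canonical S \<inter> Prop ` Atm0 = val canonical T \<inter> Prop ` Atm0"
    and x: "x \<in> Val" "Atom (Dec x) \<in> S"
  shows "Atom (Dec x) \<in> T"
proof -
  note m = R_mcs[OF ST]
  \<comment> \<open>\<open>X\<close> collects the inputs true at \<open>S\<close>, and by
    \<open>eq\<close> those true at \<open>T\<close>, so the same \<open>cn\<close> belongs to both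
    sets.\<close>
  define X where "X = {p \<in> Atm0. Atom (Prop p) \<in> S}"
  have "p \<in> Atm0 \<Longrightarrow> Atom (Prop p) \<in> T \<longleftrightarrow> Atom (Prop p) \<in> S" for p
    using eq by auto
  then have XT: "X = {p \<in> Atm0. Atom (Prop p) \<in> T}" unfolding X_def by auto
  have X: "X \<subseteq> Atm0" "finite X" using finite_Atm0 by (auto simp: X_def)
  let ?cn = "cn Atm0 Val X Atm0"
  have "prop_eval (\<lambda>\<psi>. \<psi> \<in> S) ?cn"
    using X finite_Atm0 by (auto simp: X_def)
  then have "?cn \<in> S" using mcs_prop_eval m X by simp
  then have "Conj ?cn (Atom (Dec x)) \<in> S" using x m mcs_Conj by blast
  then have "Box MI (Imp ?cn (Atom (Dec x))) \<in> S"
    using mcs_PLC_MP[OF m(1) PLC_Funct[OF X(1) x(1)]] by blast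
  then have "Imp ?cn (Atom (Dec x)) \<in> T" by (rule R_Box[OF ST])
  moreover have "prop_eval (\<lambda>\<psi>. \<psi> \<in> T) ?cn"
    using X finite_Atm0 by (auto simp: XT)
  then have "?cn \<in> T" using mcs_prop_eval m X by simp
  ultimately show ?thesis using mcs_MP m by blast
qed

lemma canonical_Prop_mono:
  assumes "(S, T) \<in> R MF" "p \<in> Atm0" "Atom (Prop p) \<in> S"
  shows "Atom (Prop p) \<in> T"
  using R_Box[OF assms(1)] mcs_PLC_MP[OF R_mcs(1)[OF assms(1)] PLC_Indep_pos[OF assms(2)] assms(3)] .

lemma equiv_R: "equiv {S. mcs S} (R b)"
proof (intro equivI refl_onI symI transI)
  show "R b \<subseteq> {S. mcs S} \<times> {S. mcs S}" by (auto dest: R_mcs)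
qed (simp add: R_refl, fact R_sym, fact R_trans)

lemma canonical_is_MDM: "is_MDM Atm0 Val canonical"
  unfolding is_MDM_def
proof (intro conjI ballI impI)
  show "equiv (worlds canonical) (R MI)" "equiv (worlds canonical) (R MF)"
    by (simp_all add: equiv_R)
next
  fix S assume "S \<in> worlds canonical"
  then have m: "mcs S" by simp
  show "val canonical S \<subseteq> Atms Atm0 Val"
    using mcs_in_Lang[OF m] by fastforce
  have "BigDisj Atm0 Val (\<lambda>x. Atom (Dec x)) Val \<in> S"
    using mcs_PLC[OF m PLC_AtLeast] .
  \<comment> \<open>Under the membership valuation the disjunction yields a disjunct lying in
    \<open>S\<close>.\<close>
  then have "prop_eval (\<lambda>\<psi>. \<psi> \<in> S) (BigDisj Atm0 Val (\<lambda>x. Atom (Dec x)) Val)"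
    using m finite_Val by (subst mcs_prop_eval) auto
  then show "\<exists>x\<in>Val. Dec x \<in> val canonical S"
    using finite_Val by simp
  fix x y assume xy: "x \<in> Val" "y \<in> Val" "Dec x \<in> val canonical S \<and> x \<noteq> y"
  then have "Neg (Atom (Dec y)) \<in> S"
    using mcs_PLC_MP[OF m PLC_AtMost[OF xy(1,2)]] by simp
  then show "Dec y \<notin> val canonical S" using mcs_Neg m xy by auto
next
  show "R MI O R MF = R MF O R MI" using R_commute by blast
next
  fix S T
  assume *: "val canonical S \<inter> Prop ` Atm0 = val canonical T \<inter> Prop ` Atm0 \<and> (S, T) \<in> R MI"
  then have "(T, S) \<in> R MI" using R_sym by blast
  then show "val canonical S \<inter> Dec ` Val = val canonical T \<inter> Dec ` Val"
    using canonical_Dec_mono[of S T] canonical_Dec_mono[of T S] * by (simp add: set_eq_iff image_iff) blast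
next
  fix S T assume *: "(S, T) \<in> R MF"
  then show "val canonical S \<inter> Prop ` Atm0 = val canonical T \<inter> Prop ` Atm0"
    using canonical_Prop_mono[OF *] canonical_Prop_mono[OF R_sym[OF *]] by auto
qed

lemma canonical_countermodel:
  assumes "\<phi> \<in> L" "\<not> thm_of \<phi>"
  obtains S where "S \<in> worlds canonical" "\<not> sat canonical S \<phi>"
proof -
  have "\<not> derives {Neg \<phi>} Falsum"
  proof
    assume "derives {Neg \<phi>} Falsum"
    then have "derives {} (Imp (Neg \<phi>) Falsum)" using derives_insert assms(1) by simp
    then have "thm_of (Imp (Neg \<phi>) Falsum)" by (simp add: derives_def)
    then have "thm_of \<phi>" by (rule PLC_taut_MP) (use assms(1) in auto)
    then show False using assms(2) by blast
  qed
  then have "consistent {Neg \<phi>}" using assms(1) by (simp add: consistent_def)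
  then obtain S where "{Neg \<phi>} \<subseteq> S" "mcs S" by (rule lindenbaum)
  then show thesis using that[of S] truth_lemma[OF assms(1)] mcs_Neg[OF _ assms(1)] by simp
qed

end

section \<open>Countable countermodels\<close>

text \<open>Only boxed subformulas of the refuted formula need witnesses, and there are finitely
  many of them.\<close>

primrec subfms :: "('p, 'v) fm \<Rightarrow> ('p, 'v) fm set" where
  "subfms (Atom q) = {Atom q}"
| "subfms (Neg \<phi>) = insert (Neg \<phi>) (subfms \<phi>)"
| "subfms (Conj \<phi> \<psi>) = insert (Conj \<phi> \<psi>) (subfms \<phi> \<union> subfms \<psi>)"
| "subfms (Box b \<phi>) = insert (Box b \<phi>) (subfms \<phi>)"

lemma finite_subfms: "finite (subfms \<phi>)"
  by (induction \<phi>) auto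

text \<open>The closure is the union of countably many countable stages. Binary functions suffice:
  midpoints depend on two worlds, and witnesses ignore the second argument.\<close>

lemma countable_closure:
  fixes F :: "('a \<Rightarrow> 'a \<Rightarrow> 'a) set"
  assumes "countable C" "countable F"
  obtains S where "countable S" "C \<subseteq> S" "\<And>f x y. f \<in> F \<Longrightarrow> x \<in> S \<Longrightarrow> y \<in> S \<Longrightarrow> f x y \<in> S"
proof -
  define step where "step = (\<lambda>A. A \<union> (\<lambda>(f, x, y). f x y) ` (F \<times> A \<times> A))"
  define A where "A n = (step ^^ n) C" for n
  have A_Suc: "A (Suc n) = step (A n)" for n by (simp add: A_def)
  have count: "countable (A n)" for n
  proof (induction n)
    case 0
    show ?case using assms(1) by (simp add: A_def)
  next
    case (Suc n)
    then show ?case using assms(2) unfolding A_Suc step_def by (intro countable_Un) auto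
  qed
  have mono: "mono A" unfolding A_Suc mono_iff_le_Suc by (auto simp: step_def)
  have closed: "f x y \<in> (\<Union>n. A n)" if "f \<in> F" "x \<in> (\<Union>n. A n)" "y \<in> (\<Union>n. A n)" for f x y
  proof -
    from that obtain m n where "x \<in> A m" "y \<in> A n" by blast
    \<comment> \<open>The two arguments may appear at different stages; the later one contains
      both.\<close>
    then have "x \<in> A (max m n)" "y \<in> A (max m n)"
      using monoD[OF mono, of m "max m n"] monoD[OF mono, of n "max m n"] by auto
    then have "f x y \<in> A (Suc (max m n))"
      using that(1) unfolding A_Suc step_def by force
    then show ?thesis by blast
  qed
  have "C \<subseteq> A 0" by (simp add: A_def)
  then show thesis
    using that[of "\<Union>n. A n"] count closed by blast
qed

text \<open>
  The pullback need not be injective: distinct worlds over the same world are related by both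
  relations and satisfy the same formulas. Only C1 and the box clause of \<open>sat\<close> need worlds of the
  original model to exist in the range.
\<close>

definition pullback :: "('w \<Rightarrow> 'a) \<Rightarrow> ('a, 'p, 'v) mdm \<Rightarrow> ('w, 'p, 'v) mdm" where
  "pullback g M = \<lparr>worlds = UNIV, rel = (\<lambda>b. {(x, y). (g x, g y) \<in> rel M b}), val = val M \<circ> g\<rparr>"

lemma pullback_simps [simp]:
  "worlds (pullback g M) = UNIV"
  "(x, y) \<in> rel (pullback g M) b \<longleftrightarrow> (g x, g y) \<in> rel M b"
  "val (pullback g M) x = val M (g x)"
  by (auto simp: pullback_def)

lemma pullback_is_MDM:
  assumes M: "is_MDM Atm0 Val M" and g: "range g \<subseteq> worlds M"
    and mid: "\<And>b c x y. (g x, g y) \<in> rel M b O rel M c \<Longrightarrow>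
      \<exists>z. (g x, g z) \<in> rel M b \<and> (g z, g y) \<in> rel M c"
  shows "is_MDM Atm0 Val (pullback g M)"
proof -
  have gw: "g x \<in> worlds M" for x using g by blast
  have eq: "equiv UNIV (rel (pullback g M) b)" for b
  proof (intro equivI refl_onI symI transI)
    show "(x, x) \<in> rel (pullback g M) b" for x using is_MDM_relD(2)[OF M gw] by simp
    show "(y, x) \<in> rel (pullback g M) b" if "(x, y) \<in> rel (pullback g M) b" for x y
      using is_MDM_relD(3)[OF M] that by simp
    show "(x, z) \<in> rel (pullback g M) b"
      if "(x, y) \<in> rel (pullback g M) b" "(y, z) \<in> rel (pullback g M) b" for x y z
      using is_MDM_relD(4)[OF M, of "g x" "g y" b "g z"] that by simp
  qed simp
  \<comment> \<open>Left to right holds for any \<open>g\<close>; the converse needs a midpoint in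
    the range of \<open>g\<close>, supplied by \<open>mid\<close>.\<close>
  have comp: "(x, y) \<in> rel (pullback g M) b O rel (pullback g M) c \<longleftrightarrow>
      (g x, g y) \<in> rel M b O rel M c" for x y b c
    using mid[of x y b c] by (simp add: relcomp_unfold) blast
  have comm: "rel (pullback g M) MI O rel (pullback g M) MF = rel (pullback g M) MF O rel (pullback g M) MI"
    using comp is_MDM_rel(2)[OF M, of MI MF] by (simp add: set_eq_iff split_paired_all)
  have *: "(\<forall>w\<in>worlds M. val M w \<subseteq> Atms Atm0 Val) \<and>
      (\<forall>w\<in>worlds M. \<forall>x\<in>Val. \<forall>y\<in>Val. Dec x \<in> val M w \<and> x \<noteq> y \<longrightarrow> Dec y \<notin> val M w) \<and>
      (\<forall>w\<in>worlds M. \<exists>x\<in>Val. Dec x \<in> val M w)"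
    using M unfolding is_MDM_def by (elim conjE, intro conjI)
  show ?thesis
    unfolding is_MDM_def pullback_simps
  proof (intro conjI ballI impI eq comm)
    show "val M (g x) \<inter> Dec ` Val = val M (g y) \<inter> Dec ` Val"
      if "val M (g x) \<inter> Prop ` Atm0 = val M (g y) \<inter> Prop ` Atm0 \<and> (g x, g y) \<in> rel M MI" for x y
      using that by (intro is_MDM_Dec_eq[OF M]) simp_all
    show "val M (g x) \<inter> Prop ` Atm0 = val M (g y) \<inter> Prop ` Atm0"
      if "(g x, g y) \<in> rel M MF" for x y
      using is_MDM_Prop_iff[OF M that] by blast
  qed (use * gw in blast)+
qed

lemma pullback_sat:
  assumes wit: "\<And>b \<psi> x. Box b \<psi> \<in> subfms \<phi> \<Longrightarrow> \<not> sat M (g x) (Box b \<psi>) \<Longrightarrow>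
      \<exists>y. (g x, g y) \<in> rel M b \<and> \<not> sat M (g y) \<psi>"
  shows "sat (pullback g M) x \<phi> \<longleftrightarrow> sat M (g x) \<phi>"
  using wit
proof (induction \<phi> arbitrary: x)
  case (Box b \<phi>)
  then have IH: "sat (pullback g M) y \<phi> \<longleftrightarrow> sat M (g y) \<phi>" for y by simp
  show ?case using Box.prems[of b \<phi> x] by (auto simp: IH)
qed simp_all

lemma countable_countermodel:
  fixes M :: "('a, 'p, 'v) mdm"
  assumes M: "is_MDM Atm0 Val M" and w: "w \<in> worlds M" "\<not> sat M w \<phi>"
    and inf: "infinite (UNIV :: 'w set)"
  shows "\<not> MDM_valid TYPE('w) Atm0 Val \<phi>"
proof -
  \<comment> \<open>\<open>wit\<close> and \<open>mid\<close> are Skolem functions. Their default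
    \<open>x\<close> makes them total; their properties are used only where a suitable world
    exists.\<close>
  define wit where "wit = (\<lambda>(b, \<psi>) x (y :: 'a).
    if \<exists>v. (x, v) \<in> rel M b \<and> \<not> sat M v \<psi> then SOME v. (x, v) \<in> rel M b \<and> \<not> sat M v \<psi> else x)"
  define mid where "mid = (\<lambda>(b, c) x y.
    if \<exists>v. (x, v) \<in> rel M b \<and> (v, y) \<in> rel M c
    then SOME v. (x, v) \<in> rel M b \<and> (v, y) \<in> rel M c else x)"
  have wit: "(x, wit (b, \<psi>) x y) \<in> rel M b \<and> \<not> sat M (wit (b, \<psi>) x y) \<psi>"
    if "\<not> sat M x (Box b \<psi>)" for x y b \<psi>
  proof -
    have "\<exists>v. (x, v) \<in> rel M b \<and> \<not> sat M v \<psi>" using that by simp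
    from someI_ex[OF this] this show ?thesis by (simp add: wit_def)
  qed
  have mid: "(x, mid (b, c) x y) \<in> rel M b \<and> (mid (b, c) x y, y) \<in> rel M c"
    if "(x, y) \<in> rel M b O rel M c" for x y b c
  proof -
    have "\<exists>v. (x, v) \<in> rel M b \<and> (v, y) \<in> rel M c" using that by auto
    from someI_ex[OF this] this show ?thesis by (simp add: mid_def)
  qed
  have UNIV_mod: "(UNIV :: modality set) = {MI, MF}" by (auto intro: modality.exhaust)
  let ?F = "wit ` (UNIV \<times> subfms \<phi>) \<union> range mid"
  have "finite (UNIV :: modality set)" by (simp add: UNIV_mod)
  then have "finite ?F" using finite_subfms by (auto simp: finite_Prod_UNIV)
  then have "countable ?F" by (rule countable_finite)
  moreover have "countable {w}" by simp
  ultimately obtain S where S: "countable S" "{w} \<subseteq> S"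
    "\<And>f x y. f \<in> ?F \<Longrightarrow> x \<in> S \<Longrightarrow> y \<in> S \<Longrightarrow> f x y \<in> S"
    using countable_closure[of "{w}" ?F] by metis
  \<comment> \<open>The closure lemma does not say that \<open>S\<close> stays among the worlds, so
    it is intersected with them; witnesses and midpoints survive because related points are
    worlds.\<close>
  let ?S = "S \<inter> worlds M"
  obtain h :: "nat \<Rightarrow> 'w" where h: "inj h"
    using infinite_countable_subset[OF inf] by blast
  \<comment> \<open>The inverse of the injection \<open>h\<close> maps \<open>'w\<close> onto the
    naturals, which then enumerate \<open>?S\<close>, nonempty because it contains
    \<open>w\<close>.\<close>
  define g where "g = from_nat_into ?S \<circ> inv h"
  have "range (inv h) = UNIV" using inj_imp_surj_inv[OF h] .
  moreover have "range (from_nat_into ?S) = ?S"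
    using S w(1) by (intro range_from_nat_into) auto
  ultimately have rg: "range g = ?S"
    unfolding g_def image_comp[symmetric] by simp
  have "is_MDM Atm0 Val (pullback g M)"
  proof (rule pullback_is_MDM[OF M])
    show "range g \<subseteq> worlds M" using rg by blast
  next
    fix b c x y assume *: "(g x, g y) \<in> rel M b O rel M c"
    have "g x \<in> S" "g y \<in> S" using rg by blast+
    moreover have "mid (b, c) \<in> ?F" by simp
    ultimately have "mid (b, c) (g x) (g y) \<in> S" using S(3)[of "mid (b, c)"] by blast
    moreover have "mid (b, c) (g x) (g y) \<in> worlds M"
      using mid[OF *] is_MDM_relD(1)[OF M] by blast
    ultimately have "mid (b, c) (g x) (g y) \<in> range g" using rg by blast
    then show "\<exists>z. (g x, g z) \<in> rel M b \<and> (g z, g y) \<in> rel M c"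
      using mid[OF *] by (metis imageE)
  qed
  moreover have sat: "sat (pullback g M) x \<phi> \<longleftrightarrow> sat M (g x) \<phi>" for x
  proof (rule pullback_sat)
    fix b \<psi> x assume *: "Box b \<psi> \<in> subfms \<phi>" "\<not> sat M (g x) (Box b \<psi>)"
    \<comment> \<open>\<open>?F\<close> indexes witness functions by the body of the box, so the
      body must itself be a subformula of \<open>\<phi>\<close>.\<close>
    have "\<psi> \<in> subfms \<psi>" for \<psi> :: "('p, 'v) fm" by (cases \<psi>) auto
    then have "\<psi> \<in> subfms \<phi>" using *(1) by (induction \<phi>) auto
    then have "wit (b, \<psi>) \<in> ?F" by blast
    moreover have "g x \<in> S" using rg by blast
    ultimately have "wit (b, \<psi>) (g x) (g x) \<in> S" using S(3)[of "wit (b, \<psi>)"] by blast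
    moreover have "wit (b, \<psi>) (g x) (g x) \<in> worlds M"
      using wit[OF *(2)] is_MDM_relD(1)[OF M] by blast
    ultimately have "wit (b, \<psi>) (g x) (g x) \<in> range g" using rg by blast
    then show "\<exists>y. (g x, g y) \<in> rel M b \<and> \<not> sat M (g y) \<psi>"
      using wit[OF *(2)] by (metis imageE)
  qed
  moreover obtain x where "g x = w" using rg S(2) w(1) by (metis IntI imageE insert_subset)
  ultimately show ?thesis
    using w(2) unfolding MDM_valid_def valid_in_def by (metis UNIV_I pullback_simps(1))
qed

theorem theorem2:
  fixes Atm0 :: "'p set" and Val :: "'v set" and \<phi> :: "('p, 'v) fm"
  assumes "finite Atm0" and "finite Val" and "\<phi> \<in> Lang Atm0 Val"
  shows "(PLC Atm0 Val \<phi> \<longrightarrow> MDM_valid TYPE('w) Atm0 Val \<phi>) \<and>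
         (infinite (UNIV :: 'w set) \<longrightarrow> MDM_valid TYPE('w) Atm0 Val \<phi> \<longrightarrow> PLC Atm0 Val \<phi>)"
proof (intro conjI impI)
  assume "PLC Atm0 Val \<phi>"
  then show "MDM_valid TYPE('w) Atm0 Val \<phi>"
    unfolding MDM_valid_def valid_in_def
    by (intro allI impI ballI) (rule PLC_sound[OF _ assms(1,2)])
next
  assume inf: "infinite (UNIV :: 'w set)" and valid: "MDM_valid TYPE('w) Atm0 Val \<phi>"
  interpret plc Atm0 Val
    using assms(1,2) Lang_imp_Atms_nonempty[OF assms(3)] by (rule plc.intro)
  show "PLC Atm0 Val \<phi>"
  proof (rule ccontr)
    assume "\<not> PLC Atm0 Val \<phi>"
    with assms(3) obtain S where "S \<in> worlds canonical" "\<not> sat canonical S \<phi>"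
      by (rule canonical_countermodel)
    from countable_countermodel[OF canonical_is_MDM this inf] valid show False
      by (rule notE)
  qed
qed

end
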